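(* Let $f,v\in W_0^{1,p}(\Omega)\setminus\{0\}$ satisfy $$\int_\Omega|\nabla v|^{p-2}\langle\nabla v,\nabla\psi\rangle\,dx=\int_\Omega|f|^{p-2}f\,\psi\,dx\quad\text{for any }\psi\in W_0^{1,p}(\Omega).$$ Then $R[v]\leqslant R[f]$. Moreover, $R[v]=R[f]$ if and only if $f$ is an eigenfunction, so that (in this case) $v=(R[f])^{1/(1-p)}f$.
   Context: $1<p<\infty$ and $\Omega\subset\mathbb{R}^D$, $D\geqslant1$, is a domain of finite measure. The Rayleigh quotient of $u\in W_0^{1,p}(\Omega)\setminus\{0\}$ is $R[u]=\int_\Omega|\nabla u|^p\,dx/\int_\Omega|u|^p\,dx$. A function $u\in W_0^{1,p}(\Omega)\setminus\{0\}$ is an eigenfunction (of the Dirichlet $p$-Laplacian) if there is $\lambda\in\mathbb{R}$ (the eigenvalue) such that $\int_\Omega|\nabla u|^{p-2}\langle\nabla u,\nabla\psi\rangle\,dx=\lambda\int_\Omega|u|^{p-2}u\,\psi\,dx$ for all $\psi\in W_0^{1,p}(\Omega)$. *)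

theory Defs
  imports "HOL-Analysis.Analysis"
begin

definition grad :: "('a::euclidean_space \<Rightarrow> real) \<Rightarrow> 'a \<Rightarrow> 'a" where
  "grad \<phi> x = (\<Sum>b\<in>Basis. frechet_derivative \<phi> (at x) b *\<^sub>R b)"

(* C^k on the whole space, by recursion on the partial derivatives. *)
primrec Ck :: "nat \<Rightarrow> ('a::euclidean_space \<Rightarrow> real) \<Rightarrow> bool" where
  "Ck 0 \<phi> \<longleftrightarrow> continuous_on UNIV \<phi>"
| "Ck (Suc k) \<phi> \<longleftrightarrow> \<phi> differentiable_on UNIV \<and>
     (\<forall>b\<in>Basis. Ck k (\<lambda>x. frechet_derivative \<phi> (at x) b))"

(* Elements of the space of compactly supported smooth functions on \<Omega> are
   represented by their extensions by zero to the whole space. *)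
definition test_functions :: "'a::euclidean_space set \<Rightarrow> ('a \<Rightarrow> real) set" where
  "test_functions \<Omega> =
     {\<phi>. (\<forall>k. Ck k \<phi>) \<and> compact (closure {x. \<phi> x \<noteq> 0}) \<and> closure {x. \<phi> x \<noteq> 0} \<subseteq> \<Omega>}"

definition locally_integrable ::
    "'a::euclidean_space set \<Rightarrow> ('a \<Rightarrow> 'b::euclidean_space) \<Rightarrow> bool" where
  "locally_integrable \<Omega> u \<longleftrightarrow> (\<forall>K. compact K \<and> K \<subseteq> \<Omega> \<longrightarrow> integrable (lebesgue_on K) u)"

definition has_weak_gradient ::
    "'a::euclidean_space set \<Rightarrow> ('a \<Rightarrow> real) \<Rightarrow> ('a \<Rightarrow> 'a) \<Rightarrow> bool" where
  "has_weak_gradient \<Omega> u G \<longleftrightarrow>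
     locally_integrable \<Omega> u \<and> locally_integrable \<Omega> G \<and>
     (\<forall>\<phi>\<in>test_functions \<Omega>.
        (LINT x|lebesgue_on \<Omega>. u x *\<^sub>R grad \<phi> x) = - (LINT x|lebesgue_on \<Omega>. \<phi> x *\<^sub>R G x))"

(* A representative: weak gradients are unique only up to null sets. Its value is
   unspecified if u has no weak gradient. *)
definition wgrad :: "'a::euclidean_space set \<Rightarrow> ('a \<Rightarrow> real) \<Rightarrow> 'a \<Rightarrow> 'a" where
  "wgrad \<Omega> u = (SOME G. has_weak_gradient \<Omega> u G)"

(* Functions here are not identified when equal almost everywhere; equality in
   L^p and W^{1,p} has to be stated with AE. *)
definition Lp :: "real \<Rightarrow> 'a::euclidean_space set \<Rightarrow> ('a \<Rightarrow> 'b::euclidean_space) set" where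
  "Lp p \<Omega> = {u \<in> borel_measurable (lebesgue_on \<Omega>).
              integrable (lebesgue_on \<Omega>) (\<lambda>x. norm (u x) powr p)}"

definition W1p :: "real \<Rightarrow> 'a::euclidean_space set \<Rightarrow> ('a \<Rightarrow> real) set" where
  "W1p p \<Omega> = {u \<in> Lp p \<Omega>. (\<exists>G. has_weak_gradient \<Omega> u G) \<and> wgrad \<Omega> u \<in> Lp p \<Omega>}"

(* Closure of the test functions in the norm of W^{1,p}. For a test function the
   classical gradient is its weak gradient. *)
definition W1p0 :: "real \<Rightarrow> 'a::euclidean_space set \<Rightarrow> ('a \<Rightarrow> real) set" where
  "W1p0 p \<Omega> = {u \<in> W1p p \<Omega>. \<exists>\<phi>. (\<forall>n. \<phi> n \<in> test_functions \<Omega>) \<and>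
     (\<lambda>n::nat. (LINT x|lebesgue_on \<Omega>. \<bar>\<phi> n x - u x\<bar> powr p) +
        (LINT x|lebesgue_on \<Omega>. norm (grad (\<phi> n) x - wgrad \<Omega> u x) powr p)) \<longlonglongrightarrow> 0}"

definition W1p0_nonzero :: "real \<Rightarrow> 'a::euclidean_space set \<Rightarrow> ('a \<Rightarrow> real) set" where
  "W1p0_nonzero p \<Omega> = {u \<in> W1p0 p \<Omega>. \<not> (AE x in lebesgue_on \<Omega>. u x = 0)}"

definition rayleigh :: "real \<Rightarrow> 'a::euclidean_space set \<Rightarrow> ('a \<Rightarrow> real) \<Rightarrow> real" where
  "rayleigh p \<Omega> u = (LINT x|lebesgue_on \<Omega>. norm (wgrad \<Omega> u x) powr p) /
                    (LINT x|lebesgue_on \<Omega>. \<bar>u x\<bar> powr p)"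

(* The integrands below vanish where the gradient (resp. the function) does, also
   for p < 2, since 0 powr (p - 2) = 0 and the other factor is 0. *)
definition plaplace_form ::
    "real \<Rightarrow> 'a::euclidean_space set \<Rightarrow> ('a \<Rightarrow> real) \<Rightarrow> ('a \<Rightarrow> real) \<Rightarrow> real" where
  "plaplace_form p \<Omega> u \<psi> = (LINT x|lebesgue_on \<Omega>.
     norm (wgrad \<Omega> u x) powr (p - 2) * (wgrad \<Omega> u x \<bullet> wgrad \<Omega> \<psi> x))"

definition power_form ::
    "real \<Rightarrow> 'a::euclidean_space set \<Rightarrow> ('a \<Rightarrow> real) \<Rightarrow> ('a \<Rightarrow> real) \<Rightarrow> real" where
  "power_form p \<Omega> u \<psi> = (LINT x|lebesgue_on \<Omega>. \<bar>u x\<bar> powr (p - 2) * u x * \<psi> x)"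

definition eigenfunction :: "real \<Rightarrow> 'a::euclidean_space set \<Rightarrow> ('a \<Rightarrow> real) \<Rightarrow> bool" where
  "eigenfunction p \<Omega> u \<longleftrightarrow> u \<in> W1p0_nonzero p \<Omega> \<and>
     (\<exists>\<mu>::real. \<forall>\<psi>\<in>W1p0 p \<Omega>. plaplace_form p \<Omega> u \<psi> = \<mu> * power_form p \<Omega> u \<psi>)"

end

theory Submission
  imports Defs
begin

text \<open>
  Testing the equation with v and with f and applying Hoelder's inequality to the right-hand
  and the left-hand side, respectively, gives two inequalities whose product is R[v] \<le> R[f].
  If R[v] = R[f], both Hoelder inequalities are equalities, so f is a multiple of v and the
  gradient of v is a multiple of that of f; comparing the constants shows that they agree.
  Since the two proportionalities are obtained separately, uniqueness of weak gradients
  never enters.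

  If f is an eigenfunction, then v and a multiple t f solve the same equation. Testing with
  v and f and using Young's inequality with its equality case yields that v and t f have the
  same gradient. A Poincare inequality on slabs for test functions, passed to the limit, then
  gives v = t f; working on slabs avoids any boundedness assumption on the domain.
\<close>

section \<open>Young's inequality for p-th powers with its equality case\<close>

text \<open>This is the weighted arithmetic-geometric mean inequality for 1 and
  \<open>r powr p\<close> with weights 1 - 1/p and 1/p. It follows from ln y \<le> y - 1, applied to
  both numbers divided by their weighted mean \<open>m\<close>.\<close>

lemma bernoulli_powr:
  fixes p r :: real
  assumes "1 < p" "0 \<le> r"
  shows "r \<le> (1 - 1/p) + r powr p / p" and "r = (1 - 1/p) + r powr p / p \<Longrightarrow> r = 1"
proof -
  define m where "m = (1 - 1/p) + r powr p / p"
  have m: "m > 0"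
    using assms by (simp add: m_def add_pos_nonneg)
  have "r \<le> m \<and> (r = m \<longrightarrow> r = 1)"
  proof (cases "r = 0")
    case True
    then show ?thesis using m by auto
  next
    case False
    then have r: "r > 0" using assms by simp
    have l1: "ln (1/m) \<le> 1/m - 1" and l2: "ln (r powr p / m) \<le> r powr p / m - 1"
      using m r by (intro ln_le_minus_one; simp)+
    have e2: "ln (r powr p / m) = p * ln r - ln m"
      using m r by (simp add: ln_div ln_powr)
    have e1: "ln (1/m) = - ln m"
      using m by (simp add: ln_div)
    have h1: "(1 - 1/p) * (- ln m) \<le> (1 - 1/p) * (1/m - 1)"
      using l1 assms e1 by (intro mult_left_mono) auto
    have h2: "(1/p) * (p * ln r - ln m) \<le> (1/p) * (r powr p / m - 1)"
      using l2 assms e2 by (intro mult_left_mono) auto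
    \<comment> \<open>Division by the mean makes the weighted right-hand sides cancel; the weighted
      left-hand sides add up to ln r - ln m.\<close>
    have s: "(1 - 1/p) * (1/m - 1) + (1/p) * (r powr p / m - 1) = 0"
    proof -
      have "(1 - 1/p) * (1/m - 1) + (1/p) * (r powr p / m - 1) = ((1 - 1/p) + r powr p / p) / m - 1"
        using m assms by (simp add: field_simps)
      then show ?thesis using m by (simp add: m_def[symmetric])
    qed
    have t: "(1 - 1/p) * (- ln m) + (1/p) * (p * ln r - ln m) = ln r - ln m"
      using assms by (simp add: field_simps)
    have le: "ln r \<le> ln m"
      using h1 h2 s t by linarith
    have "r = 1" if "r = m"
    proof -
      \<comment> \<open>If \<open>r = m\<close>, the sum of the two logarithmic bounds is an
        equality, hence so is each of them. The first one, having positive weight, then forces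
        \<open>m = 1\<close>.\<close>
      have "(1 - 1/p) * (- ln m) = (1 - 1/p) * (1/m - 1)"
        using h1 h2 s t arg_cong[OF that, of ln] by linarith
      moreover have "1 - 1/p \<noteq> 0" using assms by simp
      ultimately have "- ln m = 1/m - 1" by (metis mult_left_cancel)
      then have "ln (1/m) = 1/m - 1" using e1 by simp
      then have "1/m = 1" using m by (intro ln_eq_minus_one) auto
      then show ?thesis using that by simp
    qed
    then show ?thesis using le r m by simp
  qed
  then show "r \<le> (1 - 1/p) + r powr p / p" "r = (1 - 1/p) + r powr p / p \<Longrightarrow> r = 1"
    by (auto simp: m_def)
qed

text \<open>Cauchy-Schwarz reduces the claim to the norms x and y of a and b; after division by
  \<open>x powr p\<close> it is the scalar inequality for the ratio y/x. Equality needs ratio 1 and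
  equality in Cauchy-Schwarz, that is, equal length and equal direction.\<close>

lemma young_inner:
  fixes a b :: "'b::real_inner" and p :: real
  assumes p: "1 < p"
  shows "norm a powr (p - 2) * (a \<bullet> b) \<le> (1 - 1/p) * norm a powr p + norm b powr p / p" (is "?L \<le> ?R")
    and "norm a powr (p - 2) * (a \<bullet> b) = (1 - 1/p) * norm a powr p + norm b powr p / p \<Longrightarrow> a = b"
proof -
  have "?L \<le> ?R \<and> (?L = ?R \<longrightarrow> a = b)"
  proof (cases "a = 0")
    case True
    then show ?thesis using p by auto
  next
    case False
    define x y where "x = norm a" and "y = norm b"
    have x: "x > 0" and y: "y \<ge> 0" using False by (auto simp: x_def y_def)
    have xp: "x powr p > 0" using x by simp
    have xx: "x powr (p - 2) * (x * y) = x powr p * (y/x)"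
    proof -
      have "x powr p = x powr (p - 2) * x powr 2"
        by (simp add: powr_add[symmetric])
      then show ?thesis using x by (simp add: power2_eq_square)
    qed
    have L: "?L \<le> x powr (p - 2) * (x * y)"
      unfolding x_def y_def by (intro mult_left_mono norm_cauchy_schwarz) auto
    have R: "?R = x powr p * ((1 - 1/p) + (y/x) powr p / p)"
      using x y p by (simp add: x_def[symmetric] y_def[symmetric] powr_divide field_simps)
    have B: "x powr p * (y/x) \<le> x powr p * ((1 - 1/p) + (y/x) powr p / p)"
      using bernoulli_powr(1)[OF p, of "y/x"] x y by (intro mult_left_mono) auto
    have "a = b" if "?L = ?R"
    proof -
      have "y/x = (1 - 1/p) + (y/x) powr p / p"
        using that L B R xx xp mult_left_cancel[of "x powr p"] by (metis order.antisym order_less_irrefl)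
      then have "y/x = 1"
        using bernoulli_powr(2)[OF p, of "y/x"] x y by auto
      then have yx: "y = x" using x by simp
      have "x powr (p - 2) * (a \<bullet> b) = x powr (p - 2) * (x * y)"
        using that L B R xx xp unfolding x_def by linarith
      then have "a \<bullet> b = norm a * norm b"
        using x by (simp add: x_def y_def)
      then have "norm a *\<^sub>R b = norm b *\<^sub>R a"
        by (simp add: norm_cauchy_schwarz_eq)
      then show ?thesis using yx x by (simp add: x_def y_def)
    qed
    then show ?thesis using L B R xx by linarith
  qed
  then show "?L \<le> ?R" "?L = ?R \<Longrightarrow> a = b" by auto
qed

section \<open>Integrated Young and Hoelder inequalities\<close>

context
  fixes M :: "'m measure" and F G :: "'m \<Rightarrow> 'b::euclidean_space" and p :: real
  assumes p: "1 < p"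
    and F: "F \<in> borel_measurable M" "integrable M (\<lambda>x. norm (F x) powr p)"
    and G: "G \<in> borel_measurable M" "integrable M (\<lambda>x. norm (G x) powr p)"
begin

text \<open>Young's inequality for \<open>G x\<close> and for \<open>- G x\<close> bounds the
  absolute value of the integrand by an integrable function.\<close>

lemma integrable_powr_inner: "integrable M (\<lambda>x. norm (F x) powr (p - 2) * (F x \<bullet> G x))"
proof (rule Bochner_Integration.integrable_bound)
  show "integrable M (\<lambda>x. (1 - 1/p) * norm (F x) powr p + norm (G x) powr p / p)"
    using F G by auto
  show "(\<lambda>x. norm (F x) powr (p - 2) * (F x \<bullet> G x)) \<in> borel_measurable M"
    using F(1) G(1) by measurable
  show "AE x in M. norm (norm (F x) powr (p - 2) * (F x \<bullet> G x))
      \<le> norm ((1 - 1/p) * norm (F x) powr p + norm (G x) powr p / p)"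
  proof (intro AE_I2)
    fix x
    show "norm (norm (F x) powr (p - 2) * (F x \<bullet> G x))
      \<le> norm ((1 - 1/p) * norm (F x) powr p + norm (G x) powr p / p)"
      using young_inner(1)[OF p, of "F x" "G x"] young_inner(1)[OF p, of "F x" "- G x"]
      by (auto simp: abs_le_iff)
  qed
qed

text \<open>The gap in the pointwise inequality is nonnegative; if its integral vanishes, the gap
  vanishes almost everywhere and the pointwise equality case applies.\<close>

lemma young_integral:
  "(LINT x|M. norm (F x) powr (p - 2) * (F x \<bullet> G x))
    \<le> (1 - 1/p) * (LINT x|M. norm (F x) powr p) + (LINT x|M. norm (G x) powr p) / p" (is ?le)
  "(LINT x|M. norm (F x) powr (p - 2) * (F x \<bullet> G x))
    = (1 - 1/p) * (LINT x|M. norm (F x) powr p) + (LINT x|M. norm (G x) powr p) / p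
    \<Longrightarrow> AE x in M. F x = G x" (is "?eq \<Longrightarrow> _")
proof -
  let ?g = "\<lambda>x. (1 - 1/p) * norm (F x) powr p + norm (G x) powr p / p"
  let ?f = "\<lambda>x. norm (F x) powr (p - 2) * (F x \<bullet> G x)"
  have ig: "integrable M ?g" using F G by auto
  have g: "(LINT x|M. ?g x)
     = (1 - 1/p) * (LINT x|M. norm (F x) powr p) + (LINT x|M. norm (G x) powr p) / p"
    using F G by simp
  have "(LINT x|M. ?f x) \<le> (LINT x|M. ?g x)"
    by (intro integral_mono integrable_powr_inner ig young_inner(1) p)
  then show ?le using g by simp
  assume ?eq
  then have "(LINT x|M. ?g x - ?f x) = 0"
    using Bochner_Integration.integral_diff[OF ig integrable_powr_inner] g by simp
  then have "AE x in M. ?g x - ?f x = 0"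
    using integral_nonneg_eq_0_iff_AE[OF Bochner_Integration.integrable_diff[OF ig integrable_powr_inner]]
      young_inner(1)[OF p] by auto
  then show "AE x in M. F x = G x"
    by eventually_elim (rule young_inner(2)[OF p], simp)
qed

end

text \<open>The factor \<open>s\<close> is chosen so that \<open>s *\<^sub>R G x\<close> has the
  same p-th power integral \<open>A\<close> as \<open>F\<close>. The right-hand side of Young's
  inequality then collapses to \<open>A\<close>, which is Hoelder's inequality in the form I \<le>
  A/s, and equality identifies \<open>F\<close> with the rescaled \<open>G\<close>.\<close>

lemma hoelder_inner:
  fixes F G :: "'m \<Rightarrow> 'b::euclidean_space"
  assumes p: "1 < p"
    and F: "F \<in> borel_measurable M" "integrable M (\<lambda>x. norm (F x) powr p)"
    and G: "G \<in> borel_measurable M" "integrable M (\<lambda>x. norm (G x) powr p)"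
    and A: "A = (LINT x|M. norm (F x) powr p)" "A > 0"
    and B: "B = (LINT x|M. norm (G x) powr p)" "B > 0"
    and s: "s = (A / B) powr (1/p)"
    and I: "I = (LINT x|M. norm (F x) powr (p - 2) * (F x \<bullet> G x))"
  shows "s * I \<le> A" "s * I = A \<Longrightarrow> AE x in M. F x = s *\<^sub>R G x"
proof -
  have s0: "s > 0" and sp: "s powr p * B = A"
    using A B p by (auto simp: s powr_powr)
  have nG: "norm (s *\<^sub>R G x) powr p = s powr p * norm (G x) powr p" for x
    using s0 by (simp add: powr_mult)
  have G': "(\<lambda>x. s *\<^sub>R G x) \<in> borel_measurable M" "integrable M (\<lambda>x. norm (s *\<^sub>R G x) powr p)"
    using G nG by auto
  have B': "(LINT x|M. norm (s *\<^sub>R G x) powr p) = A"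
    unfolding nG using sp B by simp
  have I': "(LINT x|M. norm (F x) powr (p - 2) * (F x \<bullet> s *\<^sub>R G x)) = s * I"
    unfolding I by (simp add: mult.left_commute)
  have "(1 - 1/p) * A + A / p = A" using p by (simp add: field_simps)
  then show "s * I \<le> A" "s * I = A \<Longrightarrow> AE x in M. F x = s *\<^sub>R G x"
    using young_integral[OF p F G'] unfolding B' I' A(1)[symmetric] by auto
qed

text \<open>Homogeneity of degree p - 1, for comparing the p-Laplace forms of functions with
  proportional gradients.\<close>

lemma powr_inner_scaleR:
  fixes a b :: "'b::real_inner"
  assumes "0 < s"
  shows "norm (s *\<^sub>R a) powr (p - 2) * (s *\<^sub>R a \<bullet> b) = s powr (p - 1) * (norm a powr (p - 2) * (a \<bullet> b))"
proof -
  have "s powr (p - 1) = s powr (p - 2) * s"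
    using assms powr_add[of s "p - 2" 1] by simp
  then show ?thesis using assms by (simp add: powr_mult)
qed

lemma integral_powr_eq_0_imp_AE:
  fixes F :: "'m \<Rightarrow> 'b::euclidean_space"
  assumes "integrable M (\<lambda>x. norm (F x) powr p)" "(LINT x|M. norm (F x) powr p) = 0"
  shows "AE x in M. F x = 0"
  using integral_nonneg_eq_0_iff_AE[OF assms(1)] assms(2) by auto

section \<open>From L^p to L^1 on a finite measure space\<close>

text \<open>A pointwise bound with a free parameter e splits the L^1 norm into e times the total
  measure and a multiple of the p-th power integral. First e is fixed small, then n is taken
  large.\<close>

lemma tendsto_L1_if_tendsto_Lp:
  fixes g :: "nat \<Rightarrow> 'm \<Rightarrow> 'b::euclidean_space"
  assumes p: "1 < p" and M: "finite_measure M"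
    and g: "\<And>n. g n \<in> borel_measurable M" "\<And>n. integrable M (\<lambda>x. norm (g n x) powr p)"
    and lim: "(\<lambda>n. LINT x|M. norm (g n x) powr p) \<longlonglongrightarrow> 0"
  shows "integrable M (g n)" and "(\<lambda>n. LINT x|M. norm (g n x)) \<longlonglongrightarrow> 0"
proof -
  interpret finite_measure M by fact
  \<comment> \<open>For a > e the bound holds because a is the product of
    \<open>a powr (1 - p)\<close> and \<open>a powr p\<close>, and the first factor is at most
    \<open>e powr (1 - p)\<close>.\<close>
  have pw: "a \<le> e + e powr (1 - p) * a powr p" if "e > 0" "a \<ge> 0" for a e :: real
  proof (cases "a \<le> e")
    case True
    then show ?thesis using that by (smt (verit) powr_ge_zero mult_nonneg_nonneg)
  next
    case False
    then have "e powr (p - 1) \<le> a powr (p - 1)" using that p by (intro powr_mono2) auto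
    then have "e powr (1 - p) * e powr (p - 1) * a \<le> e powr (1 - p) * a powr (p - 1) * a"
      using that by (intro mult_right_mono mult_left_mono) auto
    moreover have "e powr (1 - p) * e powr (p - 1) = 1"
      using that by (simp add: powr_add[symmetric])
    moreover have "a powr (p - 1) * a = a powr p"
      using False that by (simp add: powr_diff)
    ultimately show ?thesis using that by (simp add: mult.assoc)
  qed
  have int: "integrable M (g n)" for n
  proof (rule Bochner_Integration.integrable_bound)
    show "integrable M (\<lambda>x. 1 + 1 powr (1 - p) * norm (g n x) powr p)" using g by auto
    show "AE x in M. norm (g n x) \<le> norm (1 + 1 powr (1 - p) * norm (g n x) powr p)"
      using pw[of 1] by auto
  qed (use g in auto)
  then show "integrable M (g n)" .
  have bd: "(LINT x|M. norm (g n x)) \<le> e * measure M (space M) + e powr (1 - p) * (LINT x|M. norm (g n x) powr p)"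
    if "e > 0" for e n
  proof -
    have "(LINT x|M. norm (g n x)) \<le> (LINT x|M. e + e powr (1 - p) * norm (g n x) powr p)"
      using int g that pw by (intro integral_mono) auto
    also have "\<dots> = e * measure M (space M) + e powr (1 - p) * (LINT x|M. norm (g n x) powr p)"
      using g by (simp add: mult.commute)
    finally show ?thesis .
  qed
  show "(\<lambda>n. LINT x|M. norm (g n x)) \<longlonglongrightarrow> 0"
  proof (rule LIMSEQ_I)
    fix r :: real assume r: "0 < r"
    \<comment> \<open>The measure term becomes smaller than r/2; the added 1 keeps the denominator
      positive when the space is null.\<close>
    define e where "e = r / (2 * (measure M (space M) + 1))"
    have m: "measure M (space M) + 1 > 0" by (simp add: add_nonneg_pos)
    have e: "e > 0" using r m by (simp add: e_def)
    have "e * (measure M (space M) + 1) = r / 2" using m by (simp add: e_def field_simps)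
    then have e1: "e * measure M (space M) < r / 2" using e by (simp add: algebra_simps)
    have "(\<lambda>n. e powr (1 - p) * (LINT x|M. norm (g n x) powr p)) \<longlonglongrightarrow> 0"
      using tendsto_mult_right_zero[OF lim] by simp
    from LIMSEQ_D[OF this, of "r/2"] r obtain N where
      N: "\<And>n. n \<ge> N \<Longrightarrow> \<bar>e powr (1 - p) * (LINT x|M. norm (g n x) powr p)\<bar> < r/2" by auto
    show "\<exists>no. \<forall>n\<ge>no. norm ((LINT x|M. norm (g n x)) - 0) < r"
    proof (intro exI allI impI)
      fix n assume "n \<ge> N"
      have "0 \<le> (LINT x|M. norm (g n x))" by simp
      then show "norm ((LINT x|M. norm (g n x)) - 0) < r"
        using N[OF \<open>n \<ge> N\<close>] bd[OF e, of n] e1 by simp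
    qed
  qed
qed

section \<open>Gradients of test functions and a Poincare inequality on slabs\<close>

lemma frechet_derivative_eq_grad_inner:
  assumes "b \<in> Basis"
  shows "frechet_derivative \<phi> (at x) b = grad \<phi> x \<bullet> b"
  using assms by (simp add: grad_def inner_sum_left inner_Basis if_distrib cong: if_cong)

text \<open>The complement of the closed support is open, so \<phi> coincides with 0 near the
  point.\<close>

lemma grad_eq_0_outside_support:
  assumes "x \<notin> closure {x. \<phi> x \<noteq> 0}"
  shows "grad \<phi> x = 0"
proof -
  have "(\<phi> has_derivative (\<lambda>_. 0)) (at x)"
  proof (rule has_derivative_transform_within_open[where s = "- closure {x. \<phi> x \<noteq> 0}"])
    show "((\<lambda>_. 0) has_derivative (\<lambda>_. 0)) (at x)" by simp
    show "0 = \<phi> y" if "y \<in> - closure {x. \<phi> x \<noteq> 0}" for y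
      using that closure_subset[of "{x. \<phi> x \<noteq> 0}"] by auto
  qed (use assms in auto)
  then have "frechet_derivative \<phi> (at x) = (\<lambda>_. 0)"
    by (simp add: frechet_derivative_at[symmetric])
  then show ?thesis by (simp add: grad_def)
qed

lemma test_functionsD:
  assumes "\<phi> \<in> test_functions \<Omega>"
  shows "\<phi> differentiable at x" "continuous_on UNIV \<phi>" "continuous_on UNIV (grad \<phi>)"
    and "compact (closure {x. \<phi> x \<noteq> 0})" "closure {x. \<phi> x \<noteq> 0} \<subseteq> \<Omega>"
proof -
  have "Ck (Suc 0) \<phi>" using assms unfolding test_functions_def by blast
  then have d: "\<phi> differentiable_on UNIV"
    and c: "\<And>b. b \<in> Basis \<Longrightarrow> continuous_on UNIV (\<lambda>x. frechet_derivative \<phi> (at x) b)"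
    by auto
  show "\<phi> differentiable at x" using d by (simp add: differentiable_on_def)
  show "continuous_on UNIV \<phi>" using d by (rule differentiable_imp_continuous_on)
  show "continuous_on UNIV (grad \<phi>)"
    unfolding grad_def[abs_def] by (intro continuous_intros c)
  show "compact (closure {x. \<phi> x \<noteq> 0})" "closure {x. \<phi> x \<noteq> 0} \<subseteq> \<Omega>"
    using assms by (auto simp: test_functions_def)
qed

lemma grad_diff_scaleR:
  assumes "\<phi> differentiable at x" "\<eta> differentiable at x"
  shows "grad (\<lambda>x. \<phi> x - t * \<eta> x) x = grad \<phi> x - t *\<^sub>R grad \<eta> x"
proof -
  have "((\<lambda>x. \<phi> x - t * \<eta> x) has_derivative
     (\<lambda>h. frechet_derivative \<phi> (at x) h - t * frechet_derivative \<eta> (at x) h)) (at x)"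
    using assms by (intro derivative_intros) (auto simp: frechet_derivative_works)
  then have "frechet_derivative (\<lambda>x. \<phi> x - t * \<eta> x) (at x) =
     (\<lambda>h. frechet_derivative \<phi> (at x) h - t * frechet_derivative \<eta> (at x) h)"
    by (simp add: frechet_derivative_at[symmetric])
  then show ?thesis
    by (simp add: grad_def scaleR_left_diff_distrib sum_subtractf scaleR_sum_right)
qed

text \<open>
  By compact support, \<open>\<phi> x\<close> is bounded by the integral of the gradient along the whole line
  through \<open>x\<close> in direction \<open>e\<close>; each point lies on such lines for a set of base points in the
  slab of width \<open>2 * R\<close>.
\<close>
lemma poincare_slab:
  fixes \<phi> :: "'a::euclidean_space \<Rightarrow> real"
  assumes d: "\<And>x. \<phi> differentiable at x" and cont: "continuous_on UNIV (grad \<phi>)"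
    and bdd: "bounded {x. \<phi> x \<noteq> 0}" and e: "e \<in> Basis" and R: "R \<ge> 0"
  shows "(\<integral>\<^sup>+x. ennreal \<bar>\<phi> x\<bar> * indicator {x. \<bar>x \<bullet> e\<bar> \<le> R} x \<partial>lborel)
      \<le> ennreal (2 * R) * (\<integral>\<^sup>+x. ennreal (norm (grad \<phi> x)) \<partial>lborel)"
proof -
  have ne: "norm e = 1" using e by simp
  have gm[measurable]: "grad \<phi> \<in> borel_measurable borel"
    using cont by (rule borel_measurable_continuous_onI)
  define S where "S = {x::'a. \<bar>x \<bullet> e\<bar> \<le> R}"
  have S[measurable]: "S \<in> sets borel" unfolding S_def by measurable
  have pw: "ennreal \<bar>\<phi> x\<bar> \<le> (\<integral>\<^sup>+s. ennreal (norm (grad \<phi> (x + s *\<^sub>R e))) \<partial>lborel)" for x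
  proof -
    obtain B where B: "\<And>y. \<phi> y \<noteq> 0 \<Longrightarrow> norm y \<le> B" using bdd by (auto simp: bounded_iff)
    \<comment> \<open>Moving from x by \<open>T\<close> in the unit direction e leaves the ball of
      radius \<open>B\<close> that contains all nonzero points of \<phi>, by the triangle
      inequality.\<close>
    define T where "T = \<bar>B\<bar> + norm x + 1"
    have T: "T \<ge> 0" by (simp add: T_def)
    have "norm (T *\<^sub>R e) \<le> norm (x + T *\<^sub>R e) + norm x"
      by (metis add.commute add_diff_cancel_left' norm_triangle_ineq4)
    then have "norm (x + T *\<^sub>R e) > B" using T ne by (simp add: T_def)
    then have z: "\<phi> (x + T *\<^sub>R e) = 0" using B by force
    let ?f = "\<lambda>s. grad \<phi> (x + s *\<^sub>R e) \<bullet> e"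
    have der: "DERIV (\<lambda>s. \<phi> (x + s *\<^sub>R e)) s :> ?f s" for s
    proof -
      have "((\<lambda>s. x + s *\<^sub>R e) has_derivative (\<lambda>h. h *\<^sub>R e)) (at s)"
        by (auto intro!: derivative_eq_intros)
      then have "((\<lambda>s. \<phi> (x + s *\<^sub>R e)) has_derivative
          (\<lambda>h. frechet_derivative \<phi> (at (x + s *\<^sub>R e)) (h *\<^sub>R e))) (at s)"
        using d[of "x + s *\<^sub>R e"] unfolding frechet_derivative_works
        by (rule has_derivative_compose)
      moreover have "frechet_derivative \<phi> (at (x + s *\<^sub>R e)) (h *\<^sub>R e) = h * ?f s" for h
        using linear_frechet_derivative[OF d[of "x + s *\<^sub>R e"]] frechet_derivative_eq_grad_inner[OF e]
        by (simp add: linear_cmul)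
      ultimately show ?thesis
        by (simp add: has_field_derivative_def mult.commute[of _ "?f s"])
    qed
    have "continuous_on UNIV ?f"
      by (intro continuous_intros continuous_on_compose2[OF cont]) auto
    then have ci: "isCont ?f s" for s by (simp add: continuous_on_eq_continuous_at)
    \<comment> \<open>As \<phi> vanishes at the far end, the fundamental theorem of calculus
      represents - \<phi> x as an integral over [0, T]. The bound is then enlarged to the whole
      line, which removes the dependence on \<open>T\<close>.\<close>
    have h: "has_bochner_integral lborel (\<lambda>s. ?f s * indicator {0..T} s) (\<phi> (x + T *\<^sub>R e) - \<phi> (x + 0 *\<^sub>R e))"
      by (rule has_bochner_integral_FTC_Icc_real[OF T der ci])
    then have "\<bar>\<phi> x\<bar> = norm (LINT s|lborel. ?f s * indicator {0..T} s)"
      using z by (simp add: has_bochner_integral_integral_eq)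
    also have "ennreal \<dots> \<le> (\<integral>\<^sup>+s. ennreal (norm (?f s * indicator {0..T} s)) \<partial>lborel)"
      using h by (intro integral_norm_bound_ennreal) (auto simp: has_bochner_integral_iff)
    also have "\<dots> \<le> (\<integral>\<^sup>+s. ennreal (norm (grad \<phi> (x + s *\<^sub>R e))) \<partial>lborel)"
    proof (intro nn_integral_mono ennreal_leI)
      fix s show "norm (?f s * indicator {0..T} s) \<le> norm (grad \<phi> (x + s *\<^sub>R e))"
        using Cauchy_Schwarz_ineq2[of "grad \<phi> (x + s *\<^sub>R e)" e] ne by (auto simp: indicator_def)
    qed
    finally show ?thesis .
  qed
  \<comment> \<open>Translation by s e moves the dependence on s from the gradient into the
    indicator of the slab.\<close>
  have shift: "(\<integral>\<^sup>+x. ennreal (norm (grad \<phi> (x + s *\<^sub>R e))) * indicator S x \<partial>lborel)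
     = (\<integral>\<^sup>+y. ennreal (norm (grad \<phi> y)) * indicator S (y - s *\<^sub>R e) \<partial>lborel)" for s
  proof -
    have "(\<integral>\<^sup>+y. ennreal (norm (grad \<phi> y)) * indicator S (y - s *\<^sub>R e) \<partial>lborel)
       = (\<integral>\<^sup>+y. ennreal (norm (grad \<phi> y)) * indicator S (y - s *\<^sub>R e) \<partial>distr lborel borel ((+) (s *\<^sub>R e)))"
      by (simp only: lborel_distr_plus)
    also have "\<dots> = (\<integral>\<^sup>+x. ennreal (norm (grad \<phi> (s *\<^sub>R e + x))) * indicator S (s *\<^sub>R e + x - s *\<^sub>R e) \<partial>lborel)"
      by (subst nn_integral_distr) auto
    finally show ?thesis by (simp add: add.commute)
  qed
  \<comment> \<open>Since e is a unit vector, the e-coordinate of y - s e is that of y minus s; the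
    admissible s form an interval of length 2 R, whatever y is.\<close>
  have len: "(\<integral>\<^sup>+s. indicator S (y - s *\<^sub>R e) \<partial>lborel) = ennreal (2 * R)" for y
  proof -
    have "(\<lambda>s. indicator S (y - s *\<^sub>R e)) = (indicator {y \<bullet> e - R .. y \<bullet> e + R} :: real \<Rightarrow> ennreal)"
      using e by (auto simp: fun_eq_iff S_def indicator_def inner_diff_left abs_le_iff)
    then show ?thesis using R by simp
  qed
  have "(\<integral>\<^sup>+x. ennreal \<bar>\<phi> x\<bar> * indicator S x \<partial>lborel)
     \<le> (\<integral>\<^sup>+x. (\<integral>\<^sup>+s. ennreal (norm (grad \<phi> (x + s *\<^sub>R e))) * indicator S x \<partial>lborel) \<partial>lborel)"
    by (subst nn_integral_multc) (auto intro!: nn_integral_mono mult_right_mono pw)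
  \<comment> \<open>Tonelli is used twice: here to translate in x for fixed s, and again below to
    integrate over s for fixed y.\<close>
  also have "\<dots> = (\<integral>\<^sup>+s. (\<integral>\<^sup>+x. ennreal (norm (grad \<phi> (x + s *\<^sub>R e))) * indicator S x \<partial>lborel) \<partial>lborel)"
    by (rule lborel_pair.Fubini'[symmetric]) measurable
  also have "\<dots> = (\<integral>\<^sup>+s. (\<integral>\<^sup>+y. ennreal (norm (grad \<phi> y)) * indicator S (y - s *\<^sub>R e) \<partial>lborel) \<partial>lborel)"
    by (simp only: shift)
  also have "\<dots> = (\<integral>\<^sup>+y. (\<integral>\<^sup>+s. ennreal (norm (grad \<phi> y)) * indicator S (y - s *\<^sub>R e) \<partial>lborel) \<partial>lborel)"
    by (rule lborel_pair.Fubini') measurable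
  also have "\<dots> = (\<integral>\<^sup>+y. ennreal (norm (grad \<phi> y)) * ennreal (2 * R) \<partial>lborel)"
    by (subst nn_integral_cmult) (auto simp: len)
  also have "\<dots> = ennreal (2 * R) * (\<integral>\<^sup>+y. ennreal (norm (grad \<phi> y)) \<partial>lborel)"
    by (subst nn_integral_multc) (auto simp: mult.commute)
  finally show ?thesis unfolding S_def .
qed

section \<open>L^1 approximation by test functions and recovery of a function from its
  gradient\<close>

lemma LpD:
  assumes "F \<in> Lp p \<Omega>"
  shows "F \<in> borel_measurable (lebesgue_on \<Omega>)"
    and "integrable (lebesgue_on \<Omega>) (\<lambda>x. norm (F x) powr p)"
  using assms by (auto simp: Lp_def)

text \<open>The norm of a difference is at most twice the larger norm, so its p-th power is
  dominated by a multiple of the sum of the p-th powers.\<close>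

lemma Lp_diff:
  assumes "0 < p" "F \<in> Lp p \<Omega>" "G \<in> Lp p \<Omega>"
  shows "(\<lambda>x. F x - G x) \<in> Lp p \<Omega>"
proof -
  note [measurable] = LpD(1)[OF assms(2)] LpD(1)[OF assms(3)]
  have bd: "norm (a - b) powr p \<le> 2 powr p * (norm a powr p + norm b powr p)" for a b :: 'b
  proof -
    have "norm (a - b) powr p \<le> (2 * max (norm a) (norm b)) powr p"
      using norm_triangle_ineq4[of a b] assms(1) by (intro powr_mono2) auto
    also have "\<dots> = 2 powr p * max (norm a) (norm b) powr p"
      by (intro powr_mult)
    also have "\<dots> \<le> 2 powr p * (norm a powr p + norm b powr p)"
      by (intro mult_left_mono) (auto simp: max_def)
    finally show ?thesis .
  qed
  have "integrable (lebesgue_on \<Omega>) (\<lambda>x. norm (F x - G x) powr p)"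
  proof (rule Bochner_Integration.integrable_bound)
    show "integrable (lebesgue_on \<Omega>) (\<lambda>x. 2 powr p * (norm (F x) powr p + norm (G x) powr p))"
      using LpD(2)[OF assms(2)] LpD(2)[OF assms(3)] by auto
    show "AE x in lebesgue_on \<Omega>. norm (norm (F x - G x) powr p)
        \<le> norm (2 powr p * (norm (F x) powr p + norm (G x) powr p))"
      using bd by (intro AE_I2) auto
  qed measurable
  then show ?thesis by (simp add: Lp_def)
qed

lemma finite_measure_lebesgue_on_if_open:
  fixes \<Omega> :: "'a::euclidean_space set"
  assumes "open \<Omega>" "emeasure lebesgue \<Omega> < \<infinity>"
  shows "finite_measure (lebesgue_on \<Omega>)"
proof (rule finite_measureI)
  have "\<Omega> \<inter> space lebesgue \<in> sets lebesgue" using assms(1) by simp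
  then have "emeasure (lebesgue_on \<Omega>) \<Omega> = emeasure lebesgue \<Omega>"
    by (rule emeasure_restrict_space) simp
  then show "emeasure (lebesgue_on \<Omega>) (space (lebesgue_on \<Omega>)) \<noteq> \<infinity>"
    using assms(2) by (simp add: space_restrict_space)
qed

lemma Lp_if_continuous_compact_support:
  fixes F :: "'a::euclidean_space \<Rightarrow> 'b::euclidean_space"
  assumes F: "continuous_on UNIV F" and K: "compact K" "\<And>x. x \<notin> K \<Longrightarrow> F x = 0"
    and p: "0 < p" and \<Omega>: "open \<Omega>" "emeasure lebesgue \<Omega> < \<infinity>"
  shows "F \<in> Lp p \<Omega>"
proof -
  have "F \<in> borel_measurable lebesgue"
    using borel_measurable_continuous_onI[OF F] by (simp add: measurable_completion)
  then have m[measurable]: "F \<in> borel_measurable (lebesgue_on \<Omega>)"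
    by (rule measurable_restrict_space1)
  \<comment> \<open>Inserting 0 covers the values of \<open>F\<close> off \<open>K\<close>, so a
    bound for this set bounds \<open>F\<close> everywhere.\<close>
  have "compact (insert 0 (F ` K))"
    using K(1) F by (intro compact_insert compact_continuous_image) (auto intro: continuous_on_subset)
  then obtain B where B': "\<forall>y\<in>insert 0 (F ` K). norm y \<le> B"
    using compact_imp_bounded bounded_iff by metis
  have B: "norm (F x) \<le> B" for x
  proof -
    have "F x \<in> insert 0 (F ` K)" using K(2)[of x] by auto
    then show ?thesis using B' by blast
  qed
  interpret finite_measure "lebesgue_on \<Omega>"
    by (rule finite_measure_lebesgue_on_if_open[OF \<Omega>])
  have "integrable (lebesgue_on \<Omega>) (\<lambda>x. norm (F x) powr p)"
  proof (rule integrable_const_bound)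
    have "norm (norm (F x) powr p) \<le> B powr p" for x
      using powr_mono2[of p "norm (F x)" B] B[of x] p by simp
    then show "AE x in lebesgue_on \<Omega>. norm (norm (F x) powr p) \<le> B powr p" by simp
  qed measurable
  then show ?thesis using m by (simp add: Lp_def)
qed

lemma W1p0D:
  assumes "u \<in> W1p0 p \<Omega>"
  shows "u \<in> Lp p \<Omega>" "wgrad \<Omega> u \<in> Lp p \<Omega>"
  using assms by (auto simp: W1p0_def W1p_def)

text \<open>The approximating sequence in the definition of \<open>W1p0\<close> also converges in
  L^1 because the measure is finite; L^1 is the norm of the slab inequality.\<close>

lemma W1p0_L1_approximation:
  assumes u: "u \<in> W1p0 p \<Omega>" and p: "1 < p"
    and \<Omega>: "open \<Omega>" "emeasure lebesgue \<Omega> < \<infinity>"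
  obtains \<phi> where "\<forall>n::nat. \<phi> n \<in> test_functions \<Omega>"
    "\<forall>n. integrable (lebesgue_on \<Omega>) (\<lambda>x. \<phi> n x - u x)"
    "\<forall>n. integrable (lebesgue_on \<Omega>) (\<lambda>x. grad (\<phi> n) x - wgrad \<Omega> u x)"
    "(\<lambda>n. LINT x|lebesgue_on \<Omega>. \<bar>\<phi> n x - u x\<bar>) \<longlonglongrightarrow> 0"
    "(\<lambda>n. LINT x|lebesgue_on \<Omega>. norm (grad (\<phi> n) x - wgrad \<Omega> u x)) \<longlonglongrightarrow> 0"
proof -
  obtain \<phi> where \<phi>: "\<And>n. \<phi> n \<in> test_functions \<Omega>"
    and lim: "(\<lambda>n::nat. (LINT x|lebesgue_on \<Omega>. \<bar>\<phi> n x - u x\<bar> powr p) +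
        (LINT x|lebesgue_on \<Omega>. norm (grad (\<phi> n) x - wgrad \<Omega> u x) powr p)) \<longlonglongrightarrow> 0"
    using u by (auto simp: W1p0_def)
  note fin = finite_measure_lebesgue_on_if_open[OF \<Omega>]
  have p0: "0 < p" using p by simp
  have z: "\<phi> n x = 0" if "x \<notin> closure {x. \<phi> n x \<noteq> 0}" for n x
    using that closure_subset[of "{x. \<phi> n x \<noteq> 0}"] by auto
  \<comment> \<open>Integrability of the p-th powers has to be secured: a non-integrable function
    has integral 0 by convention, and the limit in the definition would then say nothing.\<close>
  have d0: "(\<lambda>x. \<phi> n x - u x) \<in> Lp p \<Omega>" for n
    by (rule Lp_diff[OF p0 Lp_if_continuous_compact_support[OF test_functionsD(2,4)[OF \<phi>[of n]] z p0 \<Omega>] W1p0D(1)[OF u]])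
  have d1: "(\<lambda>x. grad (\<phi> n) x - wgrad \<Omega> u x) \<in> Lp p \<Omega>" for n
    by (rule Lp_diff[OF p0 Lp_if_continuous_compact_support[OF test_functionsD(3,4)[OF \<phi>[of n]]
      grad_eq_0_outside_support p0 \<Omega>] W1p0D(2)[OF u]])
  \<comment> \<open>Both summands are nonnegative, so each is squeezed between 0 and their
    sum.\<close>
  have l0: "(\<lambda>n. LINT x|lebesgue_on \<Omega>. norm (\<phi> n x - u x) powr p) \<longlonglongrightarrow> 0"
    by (rule tendsto_sandwich[OF _ _ tendsto_const lim]) auto
  have l1: "(\<lambda>n. LINT x|lebesgue_on \<Omega>. norm (grad (\<phi> n) x - wgrad \<Omega> u x) powr p) \<longlonglongrightarrow> 0"
    by (rule tendsto_sandwich[OF _ _ tendsto_const lim]) auto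
  note L0 = tendsto_L1_if_tendsto_Lp[OF p fin LpD[OF d0] l0]
  note L1 = tendsto_L1_if_tendsto_Lp[OF p fin LpD[OF d1] l1]
  show ?thesis
    by (rule that[of \<phi>]) (intro allI \<phi> L0(1) L1(1) L0(2)[unfolded real_norm_def] L1(2))+
qed

text \<open>With test functions approximating v and f, the combinations \<open>w n\<close> approach
  v - t f, while their gradients tend to 0 in L^1. The slab inequality makes \<open>w n\<close> tend
  to 0 in L^1 on every slab, so v - t f vanishes there.\<close>

lemma W1p0_AE_eq_if_wgrad_AE_eq:
  fixes \<Omega> :: "'a::euclidean_space set" and t :: real
  assumes p: "1 < p" and \<Omega>: "open \<Omega>" "emeasure lebesgue \<Omega> < \<infinity>"
    and v: "v \<in> W1p0 p \<Omega>" and f: "f \<in> W1p0 p \<Omega>"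
    and eq: "AE x in lebesgue_on \<Omega>. wgrad \<Omega> v x = t *\<^sub>R wgrad \<Omega> f x"
  shows "AE x in lebesgue_on \<Omega>. v x = t * f x"
proof -
  let ?M = "lebesgue_on \<Omega>"
  obtain \<phi> where \<phi>0: "\<forall>n::nat. \<phi> n \<in> test_functions \<Omega>"
    "\<forall>n. integrable ?M (\<lambda>x. \<phi> n x - v x)"
    "\<forall>n. integrable ?M (\<lambda>x. grad (\<phi> n) x - wgrad \<Omega> v x)"
    "(\<lambda>n. LINT x|?M. \<bar>\<phi> n x - v x\<bar>) \<longlonglongrightarrow> 0"
    "(\<lambda>n. LINT x|?M. norm (grad (\<phi> n) x - wgrad \<Omega> v x)) \<longlonglongrightarrow> 0"
    by (rule W1p0_L1_approximation[OF v p \<Omega>])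
  note \<phi> = \<phi>0[rule_format]
  obtain \<eta> where \<eta>0: "\<forall>n::nat. \<eta> n \<in> test_functions \<Omega>"
    "\<forall>n. integrable ?M (\<lambda>x. \<eta> n x - f x)"
    "\<forall>n. integrable ?M (\<lambda>x. grad (\<eta> n) x - wgrad \<Omega> f x)"
    "(\<lambda>n. LINT x|?M. \<bar>\<eta> n x - f x\<bar>) \<longlonglongrightarrow> 0"
    "(\<lambda>n. LINT x|?M. norm (grad (\<eta> n) x - wgrad \<Omega> f x)) \<longlonglongrightarrow> 0"
    by (rule W1p0_L1_approximation[OF f p \<Omega>])
  note \<eta> = \<eta>0[rule_format]
  have \<Omega>m: "\<Omega> \<inter> space lebesgue \<in> sets lebesgue" using \<Omega> by auto
  obtain e :: 'a where e: "e \<in> Basis" using nonempty_Basis by blast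
  define w where "w n x = \<phi> n x - t * \<eta> n x" for n x
  have gw: "grad (w n) x = grad (\<phi> n) x - t *\<^sub>R grad (\<eta> n) x" for n x
    unfolding w_def[abs_def]
    by (rule grad_diff_scaleR[OF test_functionsD(1)[OF \<phi>(1)] test_functionsD(1)[OF \<eta>(1)]])
  \<comment> \<open>This reduces the whole-space gradient integral of the slab inequality to an
    integral over \<Omega>.\<close>
  have gw0: "grad (w n) x = 0" if "x \<notin> \<Omega>" for n x
  proof -
    have "x \<notin> closure {x. \<phi> n x \<noteq> 0}" "x \<notin> closure {x. \<eta> n x \<noteq> 0}"
      using that test_functionsD(5)[OF \<phi>(1)[of n]] test_functionsD(5)[OF \<eta>(1)[of n]] by blast+
    then show ?thesis by (simp add: gw grad_eq_0_outside_support)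
  qed
  note [measurable] = LpD(1)[OF W1p0D(1)[OF v]] LpD(1)[OF W1p0D(1)[OF f]]
  have slab: "AE x in ?M. \<bar>x \<bullet> e\<bar> \<le> R \<longrightarrow> v x = t * f x" if R: "R \<ge> 0" for R :: real
  proof -
    define S where "S = {x::'a. \<bar>x \<bullet> e\<bar> \<le> R}"
    have "S \<in> sets borel" unfolding S_def by measurable
    then have Sl: "S \<in> sets lebesgue" by simp
    then have S[measurable]: "indicator S \<in> borel_measurable ?M"
      by (intro measurable_restrict_space1) auto
    \<comment> \<open>\<open>a n\<close> controls the L^1 distance from \<open>w n\<close> to v - t
      f, and \<open>b n\<close> the L^1 norm of the gradient of \<open>w n\<close>.\<close>
    define a where "a n = (LINT x|?M. \<bar>\<phi> n x - v x\<bar>) + \<bar>t\<bar> * (LINT x|?M. \<bar>\<eta> n x - f x\<bar>)" for n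
    define b where "b n = (LINT x|?M. norm (grad (\<phi> n) x - wgrad \<Omega> v x))
        + \<bar>t\<bar> * (LINT x|?M. norm (grad (\<eta> n) x - wgrad \<Omega> f x))" for n
    have b0: "b n \<ge> 0" and a0: "a n \<ge> 0" for n by (auto simp: a_def b_def)
    have wS: "(\<integral>\<^sup>+x. ennreal \<bar>w n x\<bar> * indicator S x \<partial>?M) \<le> ennreal (2 * R * b n)" for n
    proof -
      have bdd: "bounded {x. w n x \<noteq> 0}"
      proof (rule bounded_subset)
        show "bounded (closure {x. \<phi> n x \<noteq> 0} \<union> closure {x. \<eta> n x \<noteq> 0})"
          using test_functionsD(4)[OF \<phi>(1)[of n]] test_functionsD(4)[OF \<eta>(1)[of n]]
          by (simp add: compact_imp_bounded)
        show "{x. w n x \<noteq> 0} \<subseteq> closure {x. \<phi> n x \<noteq> 0} \<union> closure {x. \<eta> n x \<noteq> 0}"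
        proof
          fix x assume "x \<in> {x. w n x \<noteq> 0}"
          then have "\<phi> n x \<noteq> 0 \<or> \<eta> n x \<noteq> 0" by (auto simp: w_def)
          then show "x \<in> closure {x. \<phi> n x \<noteq> 0} \<union> closure {x. \<eta> n x \<noteq> 0}"
            using closure_subset[of "{x. \<phi> n x \<noteq> 0}"] closure_subset[of "{x. \<eta> n x \<noteq> 0}"] by blast
        qed
      qed
      have diff: "w n differentiable at x" for x
        unfolding w_def[abs_def] using test_functionsD(1)[OF \<phi>(1)[of n]] test_functionsD(1)[OF \<eta>(1)[of n]]
        by (intro differentiable_diff differentiable_mult differentiable_const)
      have cont: "continuous_on UNIV (grad (w n))"
        unfolding gw[abs_def] using test_functionsD(3)[OF \<phi>(1)[of n]] test_functionsD(3)[OF \<eta>(1)[of n]]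
        by (intro continuous_intros)
      have int: "integrable ?M (\<lambda>x. norm (grad (\<phi> n) x - wgrad \<Omega> v x)
          + \<bar>t\<bar> * norm (grad (\<eta> n) x - wgrad \<Omega> f x))"
        using \<phi>(3) \<eta>(3) by auto
      have "(\<integral>\<^sup>+x. ennreal \<bar>w n x\<bar> * indicator S x \<partial>?M)
          = (\<integral>\<^sup>+x. ennreal \<bar>w n x\<bar> * indicator S x * indicator \<Omega> x \<partial>lebesgue)"
        using \<Omega>m by (simp add: nn_integral_restrict_space)
      also have "\<dots> \<le> (\<integral>\<^sup>+x. ennreal \<bar>w n x\<bar> * indicator S x \<partial>lebesgue)"
        by (intro nn_integral_mono) (auto simp: indicator_def)
      \<comment> \<open>The slab inequality is formulated for Borel measure; completion does not
        change the integral.\<close>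
      also have "\<dots> = (\<integral>\<^sup>+x. ennreal \<bar>w n x\<bar> * indicator S x \<partial>lborel)"
        by (rule nn_integral_completion)
      also have "\<dots> \<le> ennreal (2 * R) * (\<integral>\<^sup>+x. ennreal (norm (grad (w n) x)) \<partial>lborel)"
        unfolding S_def by (rule poincare_slab[OF diff cont bdd e R])
      also have "(\<integral>\<^sup>+x. ennreal (norm (grad (w n) x)) \<partial>lborel)
          = (\<integral>\<^sup>+x. ennreal (norm (grad (w n) x)) \<partial>lebesgue)"
        by (rule nn_integral_completion[symmetric])
      also have "\<dots> = (\<integral>\<^sup>+x. ennreal (norm (grad (w n) x)) * indicator \<Omega> x \<partial>lebesgue)"
        by (intro nn_integral_cong) (auto simp: indicator_def gw0)
      also have "\<dots> = (\<integral>\<^sup>+x. ennreal (norm (grad (w n) x)) \<partial>?M)"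
        using \<Omega>m by (simp add: nn_integral_restrict_space)
      also have "\<dots> \<le> (\<integral>\<^sup>+x. ennreal (norm (grad (\<phi> n) x - wgrad \<Omega> v x)
          + \<bar>t\<bar> * norm (grad (\<eta> n) x - wgrad \<Omega> f x)) \<partial>?M)"
      \<comment> \<open>By \<open>eq\<close> the two weak gradients cancel in the combination,
        leaving only the approximation errors.\<close>
      proof (rule nn_integral_mono_AE, use eq in eventually_elim)
        fix x assume "wgrad \<Omega> v x = t *\<^sub>R wgrad \<Omega> f x"
        then have "grad (w n) x = (grad (\<phi> n) x - wgrad \<Omega> v x) - t *\<^sub>R (grad (\<eta> n) x - wgrad \<Omega> f x)"
          by (simp add: gw algebra_simps)
        then have "norm (grad (w n) x) \<le> norm (grad (\<phi> n) x - wgrad \<Omega> v x)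
          + \<bar>t\<bar> * norm (grad (\<eta> n) x - wgrad \<Omega> f x)"
          by (metis norm_scaleR norm_triangle_ineq4)
        then show "ennreal (norm (grad (w n) x)) \<le> ennreal (norm (grad (\<phi> n) x - wgrad \<Omega> v x)
          + \<bar>t\<bar> * norm (grad (\<eta> n) x - wgrad \<Omega> f x))"
          by (rule ennreal_leI)
      qed
      also have "\<dots> = ennreal (b n)"
        using \<phi>(3)[of n] \<eta>(3)[of n] by (subst nn_integral_eq_integral[OF int]) (auto simp: b_def)
      finally show ?thesis
        using R b0 by (simp add: ennreal_mult' mult_left_mono)
    qed
    have bound: "(\<integral>\<^sup>+x. ennreal \<bar>v x - t * f x\<bar> * indicator S x \<partial>?M) \<le> ennreal (a n + 2 * R * b n)" for n
    proof -
      have int: "integrable ?M (\<lambda>x. \<bar>\<phi> n x - v x\<bar> + \<bar>t\<bar> * \<bar>\<eta> n x - f x\<bar>)"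
        using \<phi>(2) \<eta>(2) by auto
      have wm[measurable]: "w n \<in> borel_measurable ?M"
      proof -
        have "continuous_on UNIV (w n)"
          unfolding w_def[abs_def] using test_functionsD(2)[OF \<phi>(1)[of n]] test_functionsD(2)[OF \<eta>(1)[of n]]
          by (intro continuous_intros)
        then show ?thesis
          by (intro measurable_restrict_space1) (simp add: borel_measurable_continuous_onI measurable_completion)
      qed
      have "(\<integral>\<^sup>+x. ennreal \<bar>v x - t * f x\<bar> * indicator S x \<partial>?M)
          \<le> (\<integral>\<^sup>+x. ennreal (\<bar>\<phi> n x - v x\<bar> + \<bar>t\<bar> * \<bar>\<eta> n x - f x\<bar>) + ennreal \<bar>w n x\<bar> * indicator S x \<partial>?M)"
      proof (rule nn_integral_mono)
        fix x
        have "v x - t * f x = w n x - (\<phi> n x - v x) + t * (\<eta> n x - f x)"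
          by (simp add: w_def algebra_simps)
        then have "\<bar>v x - t * f x\<bar> \<le> (\<bar>\<phi> n x - v x\<bar> + \<bar>t\<bar> * \<bar>\<eta> n x - f x\<bar>) + \<bar>w n x\<bar>"
          using abs_mult[of t "\<eta> n x - f x"] by linarith
        then have "ennreal \<bar>v x - t * f x\<bar> \<le> ennreal (\<bar>\<phi> n x - v x\<bar> + \<bar>t\<bar> * \<bar>\<eta> n x - f x\<bar>) + ennreal \<bar>w n x\<bar>"
          by (subst ennreal_plus[symmetric]) (auto intro!: ennreal_leI simp del: ennreal_plus)
        then show "ennreal \<bar>v x - t * f x\<bar> * indicator S x
            \<le> ennreal (\<bar>\<phi> n x - v x\<bar> + \<bar>t\<bar> * \<bar>\<eta> n x - f x\<bar>) + ennreal \<bar>w n x\<bar> * indicator S x"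
          by (auto simp: indicator_def)
      qed
      also have "\<dots> = ennreal (a n) + (\<integral>\<^sup>+x. ennreal \<bar>w n x\<bar> * indicator S x \<partial>?M)"
      proof (subst nn_integral_add)
        show "(\<lambda>x. ennreal (\<bar>\<phi> n x - v x\<bar> + \<bar>t\<bar> * \<bar>\<eta> n x - f x\<bar>)) \<in> borel_measurable ?M"
          using int by measurable
        show "(\<lambda>x. ennreal \<bar>w n x\<bar> * indicator S x) \<in> borel_measurable ?M"
          by measurable
        show "(\<integral>\<^sup>+x. ennreal (\<bar>\<phi> n x - v x\<bar> + \<bar>t\<bar> * \<bar>\<eta> n x - f x\<bar>) \<partial>?M)
           + (\<integral>\<^sup>+x. ennreal \<bar>w n x\<bar> * indicator S x \<partial>?M)
           = ennreal (a n) + (\<integral>\<^sup>+x. ennreal \<bar>w n x\<bar> * indicator S x \<partial>?M)"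
          using \<phi>(2)[of n] \<eta>(2)[of n] by (subst nn_integral_eq_integral[OF int]) (auto simp: a_def)
      qed
      also have "\<dots> \<le> ennreal (a n) + ennreal (2 * R * b n)"
        by (intro add_left_mono wS)
      also have "\<dots> = ennreal (a n + 2 * R * b n)"
        using a0 b0 R by (intro ennreal_plus[symmetric]) auto
      finally show ?thesis .
    qed
    have "(\<lambda>n. a n + 2 * R * b n) \<longlonglongrightarrow> (0 + \<bar>t\<bar> * 0) + 2 * R * (0 + \<bar>t\<bar> * 0)"
      unfolding a_def b_def by (intro tendsto_intros \<phi>(4,5) \<eta>(4,5))
    then have "(\<lambda>n. ennreal (a n + 2 * R * b n)) \<longlonglongrightarrow> 0"
      using tendsto_ennrealI by fastforce
    \<comment> \<open>The left-hand side does not depend on n, so the vanishing upper bounds force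
      it to be 0.\<close>
    from LIMSEQ_le_const[OF this] have "(\<integral>\<^sup>+x. ennreal \<bar>v x - t * f x\<bar> * indicator S x \<partial>?M) \<le> 0"
      using bound by blast
    then have "AE x in ?M. ennreal \<bar>v x - t * f x\<bar> * indicator S x = 0"
      by (subst nn_integral_0_iff_AE[symmetric]) auto
    then show ?thesis
      by eventually_elim (auto simp: S_def indicator_def split: if_splits)
  qed
  \<comment> \<open>Countably many slabs with natural half-width cover the space, so the exceptional
    null sets can be united.\<close>
  have "AE x in ?M. \<forall>N::nat. \<bar>x \<bullet> e\<bar> \<le> real N \<longrightarrow> v x = t * f x"
    using slab by (subst AE_all_countable) auto
  then show ?thesis
    by eventually_elim (use real_arch_simple in blast)
qed

section \<open>Comparison of the Rayleigh quotients and the equality case\<close>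

theorem proposition4p2:
  fixes p :: real and \<Omega> :: "'a::euclidean_space set" and f v :: "'a \<Rightarrow> real"
  assumes "1 < p"
    and "open \<Omega>" and "connected \<Omega>" and "\<Omega> \<noteq> {}" and "emeasure lebesgue \<Omega> < \<infinity>"
    and "f \<in> W1p0_nonzero p \<Omega>" and "v \<in> W1p0_nonzero p \<Omega>"
    and "\<And>\<psi>. \<psi> \<in> W1p0 p \<Omega> \<Longrightarrow> plaplace_form p \<Omega> v \<psi> = power_form p \<Omega> f \<psi>"
  shows "rayleigh p \<Omega> v \<le> rayleigh p \<Omega> f
    \<and> (rayleigh p \<Omega> v = rayleigh p \<Omega> f \<longleftrightarrow> eigenfunction p \<Omega> f)
    \<and> (rayleigh p \<Omega> v = rayleigh p \<Omega> f \<longrightarrow>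
        (AE x in lebesgue_on \<Omega>. v x = rayleigh p \<Omega> f powr (1 / (1 - p)) * f x))"
proof -
  let ?M = "lebesgue_on \<Omega>"
  note p = assms(1) and weak = assms(8)
  have f: "f \<in> W1p0 p \<Omega>" and v: "v \<in> W1p0 p \<Omega>"
    and fnz: "\<not> (AE x in ?M. f x = 0)" and vnz: "\<not> (AE x in ?M. v x = 0)"
    using assms(6,7) by (auto simp: W1p0_nonzero_def)
  note Lf = LpD[OF W1p0D(1)[OF f]] and Lv = LpD[OF W1p0D(1)[OF v]]
    and Gf = LpD[OF W1p0D(2)[OF f]] and Gv = LpD[OF W1p0D(2)[OF v]]
  define Af Av Bf Bv where
    "Af = (LINT x|?M. norm (wgrad \<Omega> f x) powr p)" and "Av = (LINT x|?M. norm (wgrad \<Omega> v x) powr p)" and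
    "Bf = (LINT x|?M. norm (f x) powr p)" and "Bv = (LINT x|?M. norm (v x) powr p)"
  have Rf: "rayleigh p \<Omega> f = Af / Bf" and Rv: "rayleigh p \<Omega> v = Av / Bv"
    by (simp_all add: rayleigh_def Af_def Bf_def Av_def Bv_def)
  have power: "power_form p \<Omega> u \<psi> = (LINT x|?M. norm (u x) powr (p - 2) * (u x \<bullet> \<psi> x))" for u \<psi>
    by (simp add: power_form_def mult.assoc)
  have sq: "norm a powr (p - 2) * (a \<bullet> a) = norm a powr p" for a :: "'b::real_inner"
  proof (cases "a = 0")
    case False
    then show ?thesis
      using powr_add[of "norm a" "p - 2" 2] by (simp add: power2_norm_eq_inner)
  qed (use p in auto)
  have lap_diag: "plaplace_form p \<Omega> f f = Af" "plaplace_form p \<Omega> v v = Av"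
    and pow_diag: "power_form p \<Omega> f f = Bf"
    by (simp_all only: plaplace_form_def power sq Af_def Av_def Bf_def)
  have test_v: "power_form p \<Omega> f v = Av" and test_f: "plaplace_form p \<Omega> v f = Bf"
    using weak[OF v] weak[OF f] lap_diag pow_diag by auto
  have nonneg: "Af \<ge> 0" "Av \<ge> 0" "Bf \<ge> 0" "Bv \<ge> 0"
    by (auto simp: Af_def Av_def Bf_def Bv_def)
  have "Bf \<noteq> 0" "Bv \<noteq> 0"
    using integral_powr_eq_0_imp_AE[OF Lf(2)] integral_powr_eq_0_imp_AE[OF Lv(2)] fnz vnz
    by (auto simp: Bf_def Bv_def)
  then have B: "Bf > 0" "Bv > 0" using nonneg by auto
  \<comment> \<open>Either gradient vanishing would annihilate
    \<open>plaplace_form p \<Omega> v f\<close>, which equals the positive number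
    \<open>Bf\<close>.\<close>
  have "Av \<noteq> 0"
  proof
    assume "Av = 0"
    then have "AE x in ?M. wgrad \<Omega> v x = 0" unfolding Av_def by (rule integral_powr_eq_0_imp_AE[OF Gv(2)])
    then have "plaplace_form p \<Omega> v f = 0"
      unfolding plaplace_form_def by (intro integral_eq_zero_AE) auto
    then show False using test_f B by simp
  qed
  moreover have "Af \<noteq> 0"
  proof
    assume "Af = 0"
    then have "AE x in ?M. wgrad \<Omega> f x = 0" unfolding Af_def by (rule integral_powr_eq_0_imp_AE[OF Gf(2)])
    then have "plaplace_form p \<Omega> v f = 0"
      unfolding plaplace_form_def by (intro integral_eq_zero_AE) auto
    then show False using test_f B by simp
  qed
  ultimately have A: "Af > 0" "Av > 0" using nonneg by auto
  \<comment> \<open>\<open>r\<close> rescales v to the L^p norm of f, and \<open>s\<close> rescales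
    the gradient of f to the L^p norm of that of v.\<close>
  define r where "r = (Bf / Bv) powr (1/p)"
  define s where "s = (Av / Af) powr (1/p)"
  have rs0: "r > 0" "s > 0" using A B by (auto simp: r_def s_def)
  have rp: "r powr p = Bf / Bv" and sp: "s powr p = Av / Af"
    using A B p by (auto simp: r_def s_def powr_powr)
  note H1 = hoelder_inner[OF p Lf Lv Bf_def B(1) Bv_def B(2) r_def power[of f v, unfolded test_v]]
  note H2 = hoelder_inner[OF p Gv Gf Av_def A(2) Af_def A(1) s_def test_f[symmetric, unfolded plaplace_form_def]]
  \<comment> \<open>The two Hoelder inequalities read r Av \<le> Bf and s Bf \<le> Av; chaining them
    gives r s \<le> 1.\<close>
  have "r * s * Bf \<le> r * Av" using H2(1) rs0 by (simp add: mult.assoc)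
  then have sBf: "r * s * Bf \<le> r * Av" "r * Av \<le> Bf" using H1(1) by auto
  then have "r * s * Bf \<le> 1 * Bf" by linarith
  then have rs: "r * s \<le> 1" using B by (simp only: mult_le_cancel_right)
  \<comment> \<open>The p-th power of r s is exactly the ratio of the Rayleigh quotients of v and
    f.\<close>
  have rsp: "(r * s) powr p = (Av / Bv) / (Af / Bf)"
    using rs0 by (simp add: powr_mult rp sp)
  have "(r * s) powr p \<le> 1 powr p" using rs rs0 p by (intro powr_mono2) auto
  then have le: "Av / Bv \<le> Af / Bf"
    unfolding rsp using A B by (simp add: field_simps)
  have equality: "(\<forall>\<psi>\<in>W1p0 p \<Omega>. plaplace_form p \<Omega> f \<psi> = (Af / Bf) * power_form p \<Omega> f \<psi>)
      \<and> (AE x in ?M. v x = (Af / Bf) powr (1 / (1 - p)) * f x)" if R: "Av / Bv = Af / Bf"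
  proof -
    \<comment> \<open>Equal quotients turn r s \<le> 1 into r s = 1, so every inequality in the
      chain is an equality and both equality cases become available.\<close>
    have "(r * s) powr p = 1" unfolding rsp R using A B by simp
    then have rs1: "r * s = 1" using rs rs0 p powr_less_mono2[of p "r * s" 1] by force
    then have r1: "r * Av = Bf" using sBf by auto
    have "s * Bf = (r * s) * Av" unfolding r1[symmetric] by (simp only: mult_ac)
    then have s1: "s * Bf = Av" using rs1 by simp
    have fv: "AE x in ?M. f x = r *\<^sub>R v x" by (rule H1(2)[OF r1])
    have gv: "AE x in ?M. wgrad \<Omega> v x = s *\<^sub>R wgrad \<Omega> f x" by (rule H2(2)[OF s1])
    have "s powr p = s powr (p - 1) * s"
      using rs0 by (simp add: powr_diff)
    moreover have "s powr p * Af = s * Bf" using sp s1 A by simp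
    ultimately have "s powr (p - 1) * s * Af = s * Bf" by simp
    \<comment> \<open>Comparing s^p Af = Av with s Bf = Av determines \<open>s\<close> from the
      Rayleigh quotient of f alone.\<close>
    then have s2: "s powr (p - 1) = Bf / Af" using rs0 A by (simp add: field_simps)
    have "s = (s powr (p - 1)) powr (1 / (p - 1))" using rs0 p by (simp add: powr_powr)
    also have "s powr (p - 1) = (Af / Bf) powr (- 1)"
      unfolding s2 using A B by (simp add: powr_minus)
    also have "((Af / Bf) powr (- 1)) powr (1 / (p - 1)) = (Af / Bf) powr (- 1 * (1 / (p - 1)))"
      by (rule powr_powr)
    also have "- 1 * (1 / (p - 1)) = 1 / (1 - p)"
      using p by (simp add: field_simps)
    finally have s3: "s = (Af / Bf) powr (1 / (1 - p))" .
    \<comment> \<open>Since r s = 1, the relation f = r v inverts to v = s f, with the same constant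
      as for the gradients.\<close>
    have "AE x in ?M. v x = s * f x"
      using fv
    proof eventually_elim
      case (elim x)
      have "s * f x = (r * s) * v x" using elim by (simp add: mult_ac)
      then show ?case using rs1 by simp
    qed
    \<comment> \<open>Replacing the gradient of v by s times that of f multiplies the form by
      s^(p-1) = Bf / Af, so the equation for v becomes the eigenvalue equation for f.\<close>
    moreover have "plaplace_form p \<Omega> f \<psi> = (Af / Bf) * power_form p \<Omega> f \<psi>" if "\<psi> \<in> W1p0 p \<Omega>" for \<psi>
    proof -
      have "plaplace_form p \<Omega> v \<psi> = (LINT x|?M. norm (wgrad \<Omega> v x) powr (p - 2) * (wgrad \<Omega> v x \<bullet> wgrad \<Omega> \<psi> x))"
        by (rule plaplace_form_def)
      also have "\<dots> = (LINT x|?M. (Bf / Af) * (norm (wgrad \<Omega> f x) powr (p - 2) * (wgrad \<Omega> f x \<bullet> wgrad \<Omega> \<psi> x)))"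
      proof (rule integral_cong_AE)
        note [measurable] = Gf(1) Gv(1) LpD(1)[OF W1p0D(2)[OF that]]
        show "(\<lambda>x. norm (wgrad \<Omega> v x) powr (p - 2) * (wgrad \<Omega> v x \<bullet> wgrad \<Omega> \<psi> x)) \<in> borel_measurable ?M"
          "(\<lambda>x. (Bf / Af) * (norm (wgrad \<Omega> f x) powr (p - 2) * (wgrad \<Omega> f x \<bullet> wgrad \<Omega> \<psi> x))) \<in> borel_measurable ?M"
          by measurable
        show "AE x in ?M. norm (wgrad \<Omega> v x) powr (p - 2) * (wgrad \<Omega> v x \<bullet> wgrad \<Omega> \<psi> x)
            = (Bf / Af) * (norm (wgrad \<Omega> f x) powr (p - 2) * (wgrad \<Omega> f x \<bullet> wgrad \<Omega> \<psi> x))"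
          using gv by eventually_elim (simp only: powr_inner_scaleR[OF rs0(2)] s2)
      qed
      also have "\<dots> = (Bf / Af) * plaplace_form p \<Omega> f \<psi>"
        by (simp add: plaplace_form_def)
      finally show ?thesis using weak[OF that] A B by (simp add: field_simps)
    qed
    ultimately show ?thesis using s3 by simp
  qed
  have eigen: "Av / Bv = Af / Bf" if ef: "eigenfunction p \<Omega> f"
  proof -
    obtain \<mu> where \<mu>: "\<And>\<psi>. \<psi> \<in> W1p0 p \<Omega> \<Longrightarrow> plaplace_form p \<Omega> f \<psi> = \<mu> * power_form p \<Omega> f \<psi>"
      using ef by (auto simp: eigenfunction_def)
    have "Af = \<mu> * Bf" using \<mu>[OF f] lap_diag pow_diag by simp
    then have \<mu>0: "\<mu> > 0" using A B by (simp add: zero_less_mult_iff)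
    \<comment> \<open>The choice makes \<mu> t^(p-1) = 1, so that t f solves the same equation as
      v.\<close>
    define t where "t = (1 / \<mu>) powr (1 / (p - 1))"
    have t0: "t > 0" using \<mu>0 by (simp add: t_def)
    have t1: "t powr (p - 1) = 1 / \<mu>" using \<mu>0 p by (simp add: t_def powr_powr)
    moreover have tp: "t powr p = t powr (p - 1) * t"
      using t0 by (simp add: powr_diff)
    ultimately have tp\<mu>: "t powr p = t / \<mu>" by simp
    have s_eq: "AE x in ?M. wgrad \<Omega> v x = t *\<^sub>R wgrad \<Omega> f x"
    proof -
      have Gt: "(\<lambda>x. t *\<^sub>R wgrad \<Omega> f x) \<in> borel_measurable ?M"
        "integrable ?M (\<lambda>x. norm (t *\<^sub>R wgrad \<Omega> f x) powr p)"
        using Gf t0 by (auto simp: powr_mult)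
      have At: "(LINT x|?M. norm (t *\<^sub>R wgrad \<Omega> f x) powr p) = t * Bf"
        using t0 \<open>Af = \<mu> * Bf\<close> \<mu>0 by (simp add: powr_mult tp\<mu> Af_def[symmetric])
      have I1: "(LINT x|?M. norm (wgrad \<Omega> v x) powr (p - 2) * (wgrad \<Omega> v x \<bullet> t *\<^sub>R wgrad \<Omega> f x)) = t * Bf"
        using test_f by (simp add: plaplace_form_def mult.left_commute)
      have "(LINT x|?M. norm (t *\<^sub>R wgrad \<Omega> f x) powr (p - 2) * (t *\<^sub>R wgrad \<Omega> f x \<bullet> wgrad \<Omega> v x))
          = (1 / \<mu>) * plaplace_form p \<Omega> f v"
        unfolding powr_inner_scaleR[OF t0] t1 by (simp add: plaplace_form_def)
      also have "\<dots> = Av" using \<mu>[OF v] test_v \<mu>0 by simp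
      finally have I2: "(LINT x|?M. norm (t *\<^sub>R wgrad \<Omega> f x) powr (p - 2) * (t *\<^sub>R wgrad \<Omega> f x \<bullet> wgrad \<Omega> v x)) = Av" .
      \<comment> \<open>Young's inequality is applied in both orders, to v tested with t f and to t
        f tested with v. Together these give t Bf = Av, which is equality in Young's inequality and
        hence equality of the gradients.\<close>
      have "t * Bf \<le> (1 - 1/p) * Av + t * Bf / p"
        using young_integral(1)[OF p Gv Gt] unfolding I1 At Av_def[symmetric] .
      moreover have "Av \<le> (1 - 1/p) * (t * Bf) + Av / p"
        using young_integral(1)[OF p Gt Gv] unfolding I2 At Av_def[symmetric] .
      ultimately have "(1 - 1/p) * (t * Bf) \<le> (1 - 1/p) * Av" "(1 - 1/p) * Av \<le> (1 - 1/p) * (t * Bf)"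
        by (simp_all add: algebra_simps)
      then have "(1 - 1/p) * (t * Bf) = (1 - 1/p) * Av" by linarith
      then have "t * Bf = Av" using p by simp
      then have "t * Bf = (1 - 1/p) * Av + t * Bf / p" by (simp add: algebra_simps)
      then show ?thesis
        using young_integral(2)[OF p Gv Gt] unfolding I1 At Av_def[symmetric] by blast
    qed
    have "AE x in ?M. v x = t * f x"
      by (rule W1p0_AE_eq_if_wgrad_AE_eq[OF p assms(2,5) v f s_eq])
    \<comment> \<open>Both integrals in the Rayleigh quotient scale by \<open>t powr p\<close>,
      which cancels.\<close>
    then have "Bv = (LINT x|?M. t powr p * norm (f x) powr p)"
      unfolding Bv_def using Lf(1) Lv(1) t0 by (intro integral_cong_AE) (auto simp: abs_mult powr_mult)
    then have "Bv = t powr p * Bf" by (simp add: Bf_def)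
    moreover have "Av = (LINT x|?M. t powr p * norm (wgrad \<Omega> f x) powr p)"
      unfolding Av_def using s_eq Gf(1) Gv(1) t0 by (intro integral_cong_AE) (auto simp: powr_mult)
    then have "Av = t powr p * Af" by (simp add: Af_def)
    ultimately show ?thesis using t0 by simp
  qed
  show ?thesis
    using le equality eigen assms(6) unfolding Rf Rv eigenfunction_def by blast
qed

end
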